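(* Let $K,C\in\mathcal{K}^n$ with $C$ full-dimensional. Then \[ n\,r(K,C)+R(K,C)\leq\frac{n+1}{2}D(K,C). \]
   Context: $\mathcal{K}^n$ denotes the set of convex bodies, i.e. (nonempty) convex compact subsets of $\mathbb{R}^n$. For $K,C\in\mathcal{K}^n$, with $C$ full-dimensional (the gauge): the circumradius $R(K,C)$ is the smallest $\lambda\geq 0$ such that a translate of $K$ is contained in $\lambda C$; the inradius $r(K,C)$ is the largest $\lambda\geq 0$ such that a translate of $K$ contains $\lambda C$; the diameter is $D(K,C)=2\max_{x,y\in K}R(\{x,y\},C)$. *)

theory Defs
  imports "HOL-Analysis.Analysis"
begin

definition convex_body :: "'a::euclidean_space set \<Rightarrow> bool" where
  "convex_body K \<longleftrightarrow> K \<noteq> {} \<and> convex K \<and> compact K"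

text \<open>
  The extremal values below are attained whenever \<open>K\<close> is nonempty and compact and \<open>C\<close> is
  a full-dimensional convex body; outside that case the operators may return unspecified values.
  The gauge \<open>C\<close> is assumed neither symmetric nor to contain the origin.
\<close>

definition circumradius :: "'a::euclidean_space set \<Rightarrow> 'a set \<Rightarrow> real" where
  "circumradius K C = (LEAST l. 0 \<le> l \<and> (\<exists>t. (+) t ` K \<subseteq> (*\<^sub>R) l ` C))"

definition inradius :: "'a::euclidean_space set \<Rightarrow> 'a set \<Rightarrow> real" where
  "inradius K C = (GREATEST l. 0 \<le> l \<and> (\<exists>t. (*\<^sub>R) l ` C \<subseteq> (+) t ` K))"

definition gauge_diameter :: "'a::euclidean_space set \<Rightarrow> 'a set \<Rightarrow> real" where
  "gauge_diameter K C = 2 * (GREATEST d. \<exists>x\<in>K. \<exists>y\<in>K. d = circumradius {x, y} C)"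

end

theory Submission
  imports Defs
begin

text \<open>
  Let \<open>n\<close> be the dimension, \<open>r\<close> the inradius, \<open>R\<close> the circumradius and \<open>d\<close> half the diameter, so that
  every pair of points of \<open>K\<close> has a translate in \<open>d C\<close>. The claim is that
  \<open>R \<le> l\<close> for \<open>l = (n + 1) d - n r\<close>, that is, that some \<open>t\<close> lies in all the compact convex sets
  \<open>l C - x\<close> with \<open>x \<in> K\<close>. By Helly's theorem it is enough to find a common \<open>t\<close> for each family of
  \<open>n + 1\<close> points \<open>x\<^sub>i\<close> of \<open>K\<close>.

  If there is none, separating the product of the sets \<open>l C - x\<^sub>i\<close> from the diagonal produces
  vectors \<open>a\<^sub>i\<close> with sum \<open>0\<close> such that \<open>\<Sum> a\<^sub>i \<bullet> x\<^sub>i > l \<Sum> h(a\<^sub>i)\<close>, where \<open>h\<close> is the support function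
  of \<open>C\<close> (\<open>no_common_translate_certificate\<close>). The opposite inequality holds for two reasons.

  \<^item> The width of \<open>K\<close> in any direction \<open>a\<close> is at most \<open>d\<close> times the width \<open>h(a) + h(-a)\<close> of \<open>C\<close>. Since \<open>K\<close>
    contains a translate \<open>r C - t\<close>, this bounds \<open>a\<^sub>i \<bullet> x\<^sub>i + r h(-a\<^sub>i) + a\<^sub>i \<bullet> t\<close> by
    \<open>d (h(a\<^sub>i) + h(-a\<^sub>i))\<close>. The terms in \<open>t\<close> cancel in the sum over \<open>i\<close>, which leaves
    \<open>\<Sum> a\<^sub>i \<bullet> x\<^sub>i \<le> d \<Sum> h(a\<^sub>i) + (d - r) \<Sum> h(-a\<^sub>i)\<close>.
  \<^item> As \<open>-a\<^sub>i\<close> is the sum of the other \<open>a\<^sub>j\<close>, sublinearity of \<open>h\<close> gives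
    \<open>\<Sum> h(-a\<^sub>i) \<le> n \<Sum> h(a\<^sub>i)\<close> (\<open>sum_opposite_support_le\<close>). With \<open>r \<le> d\<close> the bound becomes
    \<open>(d + n (d - r)) \<Sum> h(a\<^sub>i) = l \<Sum> h(a\<^sub>i)\<close>.

  The support function appears below only through points \<open>p\<^sub>i\<close> and \<open>q\<^sub>i\<close> of \<open>C\<close> that maximise and
  minimise \<open>a\<^sub>i\<close>, so that \<open>h(a\<^sub>i) = a\<^sub>i \<bullet> p\<^sub>i\<close> and \<open>h(-a\<^sub>i) = - (a\<^sub>i \<bullet> q\<^sub>i)\<close>.

  The radii and the diameter are a least or a greatest element of a set of reals, and so carry
  information only once these extrema are known to exist. Compactness gives this for the radii;
  for the diameter it follows from the Lipschitz dependence of the circumradius of a pair on the pair.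
\<close>

section \<open>Attainment of the radii and of the diameter\<close>

lemma mem_image_diff_iff: "s \<in> (\<lambda>z. z - x) ` A \<longleftrightarrow> s + x \<in> A"
  for s :: "'a::group_add"
  by (metis (no_types, lifting) add_diff_cancel diff_add_cancel image_iff)

lemma convex_add_scaled_mem:
  fixes C :: "'a::real_vector set"
  assumes "convex C" "0 \<le> l" "0 \<le> m" "y \<in> (*\<^sub>R) l ` C" "z \<in> (*\<^sub>R) m ` C"
  shows "y + z \<in> (*\<^sub>R) (l + m) ` C"
proof -
  obtain u v where u: "u \<in> C" "y = l *\<^sub>R u" and v: "v \<in> C" "z = m *\<^sub>R v"
    using assms by auto
  show ?thesis
  proof (cases "l + m = 0")
    case True
    then have "l = 0" "m = 0" using assms by auto
    then show ?thesis using u v by auto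
  next
    case False
    then have "(l / (l + m)) *\<^sub>R u + (m / (l + m)) *\<^sub>R v \<in> C"
      using assms u v by (intro convexD) (auto simp: add_divide_distrib[symmetric])
    moreover have "y + z = (l + m) *\<^sub>R ((l / (l + m)) *\<^sub>R u + (m / (l + m)) *\<^sub>R v)"
      using False u v by (simp add: scaleR_add_right)
    ultimately show ?thesis by blast
  qed
qed

lemma small_vector_mem_scaled:
  fixes C :: "'a::real_normed_vector set"
  assumes "cball p e \<subseteq> C" "0 < e" "norm w \<le> m * e"
  shows "m *\<^sub>R p + w \<in> (*\<^sub>R) m ` C"
proof -
  have "0 \<le> m * e" using assms(3) norm_ge_zero order_trans by blast
  then have m: "0 \<le> m" using assms(2) by (simp add: zero_le_mult_iff)
  show ?thesis
  proof (cases "m = 0")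
    case True
    then have "w = 0" using assms by auto
    moreover have "p \<in> C" using assms by auto
    ultimately show ?thesis using True by auto
  next
    case False
    then have "p + (1 / m) *\<^sub>R w \<in> cball p e"
      using m assms(3) by (simp add: dist_norm field_simps)
    then have "p + (1 / m) *\<^sub>R w \<in> C" using assms(1) by auto
    moreover have "m *\<^sub>R p + w = m *\<^sub>R (p + (1 / m) *\<^sub>R w)"
      using False by (simp add: scaleR_add_right)
    ultimately show ?thesis by blast
  qed
qed

text \<open>
  The admissible pairs \<open>(l, t)\<close> form an intersection, over the points \<open>x\<close> of \<open>K\<close>, of translates of the
  truncated cone of all \<open>(l, y)\<close> with \<open>y \<in> l C\<close> and \<open>0 \<le> l \<le> L\<close>. The cone is compact, hence so is
  the intersection and its projection to \<open>l\<close>. A ball inside \<open>C\<close> makes a suitable \<open>L\<close> admissible.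
\<close>

lemma circumradius_attained:
  fixes K C :: "'a::euclidean_space set"
  assumes C: "convex C" "compact C" "interior C \<noteq> {}" and K: "compact K" "K \<noteq> {}"
  shows "0 \<le> circumradius K C" "\<exists>t. (+) t ` K \<subseteq> (*\<^sub>R) (circumradius K C) ` C"
    "\<And>l t. 0 \<le> l \<Longrightarrow> (+) t ` K \<subseteq> (*\<^sub>R) l ` C \<Longrightarrow> circumradius K C \<le> l"
proof -
  define F where "F = {l. 0 \<le> l \<and> (\<exists>t. (+) t ` K \<subseteq> (*\<^sub>R) l ` C)}"
  obtain p e where pe: "0 < e" "cball p e \<subseteq> C"
    using C(3) mem_interior_cball by blast
  obtain B where B: "0 < B" "\<And>x. x \<in> K \<Longrightarrow> norm x \<le> B"
    using compact_imp_bounded[OF K(1)] bounded_pos by metis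
  define L where "L = B / e"
  have "(+) (L *\<^sub>R p) ` K \<subseteq> (*\<^sub>R) L ` C"
    using small_vector_mem_scaled[OF pe(2,1), of _ L] B(2) pe(1) unfolding L_def
    by (simp add: image_subset_iff)
  then have L: "L \<in> F" using B(1) pe(1) unfolding F_def L_def by auto
  define M where "M = (\<lambda>(l, c). (l, l *\<^sub>R c)) ` ({0..L} \<times> C)"
  have M_iff: "(l, y) \<in> M \<longleftrightarrow> l \<in> {0..L} \<and> y \<in> (*\<^sub>R) l ` C" for l y
    unfolding M_def by auto
  have "compact M" unfolding M_def
    by (intro compact_continuous_image compact_Times C(2))
       (auto simp: split_def intro!: continuous_intros)
  then have "compact ((\<lambda>q. q - (0, x)) ` M)" for x
    by (rule compact_continuous_image[rotated]) (intro continuous_intros)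
  then have "compact (\<Inter>x\<in>K. (\<lambda>q. q - (0, x)) ` M)"
    using K(2) by (intro compact_Inter) auto
  then have "compact (fst ` (\<Inter>x\<in>K. (\<lambda>q. q - (0, x)) ` M))"
    by (rule compact_continuous_image[rotated]) (intro continuous_intros)
  also have "fst ` (\<Inter>x\<in>K. (\<lambda>q. q - (0, x)) ` M) = F \<inter> {..L}"
  proof -
    have mem: "(l, t) \<in> (\<lambda>q. q - (0, x)) ` M \<longleftrightarrow> (l, t + x) \<in> M" for l t x
      using mem_image_diff_iff[of "(l, t)" "(0, x)" M] by simp
    have "l \<in> fst ` (\<Inter>x\<in>K. (\<lambda>q. q - (0, x)) ` M) \<longleftrightarrow> (\<exists>t. \<forall>x\<in>K. (l, t + x) \<in> M)" for l
      unfolding mem[symmetric] by (force simp: image_iff)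
    then show ?thesis
      unfolding F_def M_iff set_eq_iff using K(2) by (simp add: image_subset_iff) blast
  qed
  finally have "compact (F \<inter> {..L})" .
  moreover have "F \<inter> {..L} \<noteq> {}" using L by auto
  ultimately obtain m where m: "m \<in> F" "m \<le> L" "\<And>l. l \<in> F \<Longrightarrow> l \<le> L \<Longrightarrow> m \<le> l"
    using compact_attains_inf[of "F \<inter> {..L}"] by auto
  have m_min: "m \<le> l" if "l \<in> F" for l using m that by fastforce
  have "circumradius K C = m"
    unfolding circumradius_def using m(1) m_min unfolding F_def by (intro Least_equality) auto
  with m(1) m_min
  show "0 \<le> circumradius K C" "\<exists>t. (+) t ` K \<subseteq> (*\<^sub>R) (circumradius K C) ` C"
    "\<And>l t. 0 \<le> l \<Longrightarrow> (+) t ` K \<subseteq> (*\<^sub>R) l ` C \<Longrightarrow> circumradius K C \<le> l"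
    unfolding F_def by auto
qed

text \<open>
  The admissible pairs \<open>(l, t)\<close> form a closed set. Two distinct points of \<open>C\<close> bound \<open>l\<close>, because
  their \<open>l\<close>-fold distance is a distance in \<open>K\<close>, and then \<open>t \<in> l c - K\<close> bounds \<open>t\<close>.
\<close>

lemma inradius_attained:
  fixes K C :: "'a::euclidean_space set"
  assumes K: "compact K" "K \<noteq> {}" and C: "compact C" "c \<in> C" "c' \<in> C" "c \<noteq> c'"
  shows "0 \<le> inradius K C" "\<exists>t. (*\<^sub>R) (inradius K C) ` C \<subseteq> (+) t ` K"
proof -
  define G where "G = {(l, t). 0 \<le> l \<and> (*\<^sub>R) l ` C \<subseteq> (+) t ` K}"
  have in_iff: "y \<in> (+) t ` K \<longleftrightarrow> y - t \<in> K" for y t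
    by (force simp: image_iff)
  have G_alt: "G = {q. 0 \<le> fst q} \<inter> (\<Inter>x\<in>C. {q. fst q *\<^sub>R x - snd q \<in> K})"
    unfolding G_def by (auto simp: image_subset_iff in_iff)
  have "closed {q. fst q *\<^sub>R x - snd q \<in> K}" for x
  proof -
    have "closed ((\<lambda>q. fst q *\<^sub>R x - snd q) -` K)"
      by (intro closed_vimage compact_imp_closed K continuous_intros)
    then show ?thesis by (simp add: vimage_def)
  qed
  then have "closed G" unfolding G_alt
    by (intro closed_Int closed_INT closed_Collect_le continuous_intros) auto
  obtain B where B: "0 < B" "\<And>x. x \<in> K \<Longrightarrow> norm x \<le> B"
    using compact_imp_bounded[OF K(1)] bounded_pos by metis
  define L where "L = 2 * B / norm (c - c')"
  have "G \<subseteq> {0..L} \<times> cball 0 (L * norm c + B)"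
  proof clarify
    fix l t assume "(l, t) \<in> G"
    then have l: "0 \<le> l" and k: "l *\<^sub>R c - t \<in> K" "l *\<^sub>R c' - t \<in> K"
      using C unfolding G_alt by auto
    have "l *\<^sub>R (c - c') = (l *\<^sub>R c - t) - (l *\<^sub>R c' - t)" by (simp add: scaleR_diff_right)
    then have "l * norm (c - c') = norm ((l *\<^sub>R c - t) - (l *\<^sub>R c' - t))"
      using l by (metis abs_of_nonneg norm_scaleR)
    also have "\<dots> \<le> B + B" using norm_triangle_ineq4 B(2)[OF k(1)] B(2)[OF k(2)]
      by (smt (verit))
    finally have lL: "l \<le> L" using C(4) unfolding L_def by (simp add: field_simps)
    have "norm t = norm (l *\<^sub>R c - (l *\<^sub>R c - t))" by simp
    also have "\<dots> \<le> norm (l *\<^sub>R c) + B"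
      using norm_triangle_ineq4 B(2)[OF k(1)] by (smt (verit))
    also have "\<dots> \<le> L * norm c + B" using l lL by (simp add: mult_right_mono)
    finally show "l \<in> {0..L} \<and> t \<in> cball 0 (L * norm c + B)" using l lL by simp
  qed
  then have "bounded G"
    by (rule bounded_subset[rotated]) (intro bounded_Times bounded_closed_interval bounded_cball)
  with \<open>closed G\<close> have "compact G" by (simp add: compact_eq_bounded_closed)
  then have "compact (fst ` G)"
    by (rule compact_continuous_image[rotated]) (intro continuous_intros)
  moreover obtain k where "k \<in> K" using K by auto
  then have "(0, - k) \<in> G" unfolding G_alt by auto
  then have "fst ` G \<noteq> {}" by auto
  ultimately obtain m where m: "m \<in> fst ` G" "\<And>l. l \<in> fst ` G \<Longrightarrow> l \<le> m"
    using compact_attains_sup by metis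
  have G_iff: "l \<in> fst ` G \<longleftrightarrow> 0 \<le> l \<and> (\<exists>t. (*\<^sub>R) l ` C \<subseteq> (+) t ` K)" for l
    unfolding G_def by (force simp: image_iff)
  have "inradius K C = m"
    unfolding inradius_def using m unfolding G_iff by (intro Greatest_equality) auto
  with m(1)
  show "0 \<le> inradius K C" "\<exists>t. (*\<^sub>R) (inradius K C) ` C \<subseteq> (+) t ` K"
    unfolding G_iff by auto
qed

text \<open>
  If \<open>C\<close> contains a ball of radius \<open>e\<close>, then displacing points of \<open>l C\<close> by at most \<open>m e\<close> can be
  absorbed by adding \<open>m C\<close>, that is, by enlarging \<open>l\<close> to \<open>l + m\<close> and shifting everything by
  \<open>m\<close> times the centre.
\<close>

lemma circumradius_pair_perturb:
  fixes C :: "'a::euclidean_space set"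
  assumes C: "convex C" "compact C" and pe: "0 < e" "cball p e \<subseteq> C"
  shows "circumradius {x', y'} C \<le> circumradius {x, y} C + (dist x x' + dist y y') / e"
proof -
  have int: "interior C \<noteq> {}" using pe mem_interior_cball by blast
  note circ = circumradius_attained[OF C int]
  define l m where "l = circumradius {x, y} C" and "m = (dist x x' + dist y y') / e"
  obtain t where t: "t + x \<in> (*\<^sub>R) l ` C" "t + y \<in> (*\<^sub>R) l ` C"
    using circ(2)[of "{x, y}"] unfolding l_def by auto
  have l: "0 \<le> l" and m: "0 \<le> m" using circ(1)[of "{x, y}"] pe(1) unfolding l_def m_def by auto
  have "m *\<^sub>R p + (x' - x) \<in> (*\<^sub>R) m ` C" "m *\<^sub>R p + (y' - y) \<in> (*\<^sub>R) m ` C"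
    using pe(1) by (auto intro!: small_vector_mem_scaled[OF pe(2,1)]
        simp: m_def dist_norm norm_minus_commute)
  then have "(t + x) + (m *\<^sub>R p + (x' - x)) \<in> (*\<^sub>R) (l + m) ` C"
    "(t + y) + (m *\<^sub>R p + (y' - y)) \<in> (*\<^sub>R) (l + m) ` C"
    using t l m C(1) convex_add_scaled_mem by blast+
  then have "(+) (t + m *\<^sub>R p) ` {x', y'} \<subseteq> (*\<^sub>R) (l + m) ` C"
    by (simp add: algebra_simps)
  then show ?thesis using circ(3)[of "{x', y'}" "l + m"] l m unfolding l_def m_def by auto
qed

text \<open>
  By \<open>circumradius_pair_perturb\<close> the circumradius of \<open>{x, y}\<close> is a Lipschitz function of
  \<open>(x, y)\<close>, so it attains its maximum on the compact set \<open>K \<times> K\<close>.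
\<close>

lemma gauge_diameter_bounds_pairs:
  fixes K C :: "'a::euclidean_space set"
  assumes C: "convex C" "compact C" "interior C \<noteq> {}" and K: "compact K" "K \<noteq> {}"
    and xy: "x \<in> K" "y \<in> K"
  shows "2 * circumradius {x, y} C \<le> gauge_diameter K C"
proof -
  obtain p e where pe: "0 < e" "cball p e \<subseteq> C"
    using C(3) mem_interior_cball by blast
  define f where "f = (\<lambda>(x, y). circumradius {x, y} C)"
  have "\<bar>f q - f q'\<bar> \<le> 2 / e * dist q q'" for q q'
  proof -
    obtain x y x' y' where q: "q = (x, y)" "q' = (x', y')" by fastforce
    have "dist x x' + dist y y' \<le> 2 * dist q q'"
      unfolding q using dist_fst_le[of "(x, y)" "(x', y')"] dist_snd_le[of "(x, y)" "(x', y')"] by simp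
    then have "(dist x x' + dist y y') / e \<le> 2 / e * dist q q'"
      using pe(1) by (simp add: divide_right_mono)
    then show ?thesis
      using circumradius_pair_perturb[OF C(1,2) pe, of x' y' x y]
        circumradius_pair_perturb[OF C(1,2) pe, of x y x' y']
      unfolding f_def q by (simp add: dist_commute)
  qed
  then have "(2 / e)-lipschitz_on (K \<times> K) f"
    using pe(1) by (intro lipschitz_onI) (auto simp: dist_real_def)
  then have "continuous_on (K \<times> K) f" by (rule lipschitz_on_continuous_on)
  then obtain q where q: "q \<in> K \<times> K" "\<And>q'. q' \<in> K \<times> K \<Longrightarrow> f q' \<le> f q"
    using continuous_attains_sup[OF compact_Times[OF K(1) K(1)]] K(2) by (metis Times_empty)
  have "(GREATEST d. \<exists>x\<in>K. \<exists>y\<in>K. d = circumradius {x, y} C) = f q"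
    using q unfolding f_def by (intro Greatest_equality) force+
  then have "gauge_diameter K C = 2 * f q" unfolding gauge_diameter_def by simp
  moreover have "circumradius {x, y} C \<le> f q" using q(2)[of "(x, y)"] xy unfolding f_def by auto
  ultimately show ?thesis by simp
qed

section \<open>Common translates and their dual certificates\<close>

text \<open>
  Helly's theorem for finite families with more than \<open>DIM('a)\<close> members extends by compactness to
  infinite families. The hypothesis speaks of all subfamilies with at most \<open>DIM('a) + 1\<close> members,
  not only of those with exactly that many, so that it also covers families that are smaller.
\<close>

lemma compact_Helly:
  fixes \<F> :: "'a::euclidean_space set set"
  assumes "\<And>S. S \<in> \<F> \<Longrightarrow> compact S" "\<And>S. S \<in> \<F> \<Longrightarrow> convex S"
    and small: "\<And>\<G>. \<lbrakk>\<G> \<subseteq> \<F>; finite \<G>; card \<G> \<le> DIM('a) + 1\<rbrakk> \<Longrightarrow> \<Inter>\<G> \<noteq> {}"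
  shows "\<Inter>\<F> \<noteq> {}"
proof (rule compact_fip_Heine_Borel)
  fix \<G> assume G: "finite \<G>" "\<G> \<subseteq> \<F>"
  show "\<Inter>\<G> \<noteq> {}"
  proof (cases "card \<G> \<le> DIM('a) + 1")
    case False
    show ?thesis
    proof (rule Helly)
      fix \<T> assume "\<T> \<subseteq> \<G>" "card \<T> = DIM('a) + 1"
      then show "\<Inter>\<T> \<noteq> {}" using small[of \<T>] G finite_subset by auto
    qed (use False G assms(2) in auto)
  qed (use G small in auto)
qed (use assms in auto)

lemma compact_vec_components:
  fixes B :: "'m::finite \<Rightarrow> 'a::euclidean_space set"
  assumes "\<And>i. compact (B i)"
  shows "compact {z :: 'a ^ 'm. \<forall>i. z $ i \<in> B i}"
proof -
  have "\<exists>b. \<forall>x\<in>B i. norm x \<le> b" for i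
    using compact_imp_bounded[OF assms] bounded_iff by blast
  then obtain b where b: "\<And>i x. x \<in> B i \<Longrightarrow> norm x \<le> b i" by metis
  have "norm z \<le> sum b UNIV" if "\<forall>i. z $ i \<in> B i" for z :: "'a ^ 'm"
  proof -
    have "norm z \<le> (\<Sum>i\<in>UNIV. norm (z $ i))"
      unfolding norm_vec_def by (rule L2_set_le_sum) auto
    also have "\<dots> \<le> sum b UNIV" using that b by (intro sum_mono) auto
    finally show ?thesis .
  qed
  then have "bounded {z :: 'a ^ 'm. \<forall>i. z $ i \<in> B i}" unfolding bounded_iff by blast
  moreover have "closed ((\<lambda>z :: 'a ^ 'm. z $ i) -` B i)" for i
    by (intro closed_vimage compact_imp_closed assms continuous_intros)
  then have "closed {z :: 'a ^ 'm. \<forall>i. z $ i \<in> B i}"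
    by (intro closed_Collect_all) (simp add: vimage_def)
  ultimately show ?thesis by (simp add: compact_eq_bounded_closed)
qed

text \<open>
  A common translate \<open>t\<close> is a point of the diagonal of \<open>'a ^ 'm\<close> in the product of the sets
  \<open>l C - x i\<close>. If there is none, a hyperplane separates the compact product from the diagonal.
  Its normal vector has the components \<open>a i\<close>; a linear functional bounded below on the diagonal
  vanishes there, which is the condition that they sum to \<open>0\<close>.
\<close>

lemma no_common_translate_certificate:
  fixes C :: "'a::euclidean_space set" and x :: "'m::finite \<Rightarrow> 'a"
  assumes C: "convex C" "compact C" "C \<noteq> {}"
    and no: "\<nexists>t. \<forall>i. t + x i \<in> (*\<^sub>R) l ` C"
  obtains a where "(\<Sum>i\<in>UNIV. a i) = 0"
    "\<And>p. (\<And>i. p i \<in> C) \<Longrightarrow> l * (\<Sum>i\<in>UNIV. a i \<bullet> p i) < (\<Sum>i\<in>UNIV. a i \<bullet> x i)"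
proof -
  define S where "S = {z :: 'a ^ 'm. \<forall>i. z $ i \<in> (\<lambda>c. l *\<^sub>R c - x i) ` C}"
  define T where "T = range (\<lambda>t :: 'a. (\<chi> i. t) :: 'a ^ 'm)"
  have S_mem: "(\<chi> i. l *\<^sub>R p i - x i) \<in> S" if "\<And>i. p i \<in> C" for p
    using that unfolding S_def by auto
  have conv: "convex ((\<lambda>c. l *\<^sub>R c - x i) ` C)" for i
    using convex_translation_subtract[OF convex_scaling[OF C(1)], of "x i" l]
    by (simp add: image_image)
  have "convex S"
    unfolding S_def by (rule convexI) (auto intro!: convexD[OF conv])
  moreover have "compact S" unfolding S_def
    by (intro compact_vec_components compact_continuous_image continuous_intros C)
  moreover obtain c where "c \<in> C" using C(3) by blast
  then have "S \<noteq> {}" using S_mem[of "\<lambda>_. c"] by blast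
  moreover have "subspace T"
    unfolding T_def by (intro linear_subspace_image subspace_UNIV linearI) (auto simp: vec_eq_iff)
  then have "convex T" "closed T" by (auto intro: subspace_imp_convex closed_subspace)
  moreover have "S \<inter> T = {}"
  proof -
    have False if "\<forall>i. t \<in> (\<lambda>c. l *\<^sub>R c - x i) ` C" for t
    proof -
      have "t + x i \<in> (*\<^sub>R) l ` C" for i using that[rule_format, of i] by auto
      then show False using no by blast
    qed
    then show ?thesis unfolding S_def T_def by auto
  qed
  ultimately obtain a b where ab: "\<And>z. z \<in> S \<Longrightarrow> a \<bullet> z < b" "\<And>z. z \<in> T \<Longrightarrow> b < a \<bullet> z"
    using separating_hyperplane_compact_closed by metis
  define s where "s = (\<Sum>i\<in>UNIV. a $ i)"
  have diag: "b < s \<bullet> t" for t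
    using ab(2)[of "\<chi> i. t"] unfolding T_def s_def by (simp add: inner_vec_def inner_sum_left)
  have "b < 0" using diag[of 0] by simp
  \<comment> \<open>Otherwise a multiple of \<open>s\<close> on the diagonal would attain the value \<open>b\<close>.\<close>
  have "s = 0"
  proof (rule ccontr)
    assume "s \<noteq> 0"
    then have "s \<bullet> ((b / (s \<bullet> s)) *\<^sub>R s) = b" by simp
    then show False using diag by (metis less_irrefl)
  qed
  show thesis
  proof (rule that[of "\<lambda>i. a $ i"])
    show "(\<Sum>i\<in>UNIV. a $ i) = 0" using \<open>s = 0\<close> s_def by simp
    fix p :: "'m \<Rightarrow> 'a"
    assume "\<And>i. p i \<in> C"
    then have "a \<bullet> (\<chi> i. l *\<^sub>R p i - x i) < 0"
      using ab(1)[OF S_mem[of p]] \<open>b < 0\<close> by simp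
    then show "l * (\<Sum>i\<in>UNIV. a $ i \<bullet> p i) < (\<Sum>i\<in>UNIV. a $ i \<bullet> x i)"
      by (simp add: inner_vec_def inner_diff_right sum_subtractf sum_distrib_left)
  qed
qed

text \<open>
  Here \<open>a \<bullet> p - a \<bullet> q\<close> is the width of \<open>C\<close> in direction \<open>a\<close>. Points that fit into \<open>l C\<close> after a
  common translation differ by \<open>l\<close> times a difference of points of \<open>C\<close>.
\<close>

lemma pairs_width_le:
  fixes C :: "'a::euclidean_space set"
  assumes x: "t + x \<in> (*\<^sub>R) l ` C" and y: "t + y \<in> (*\<^sub>R) l ` C" and l: "0 \<le> l" "l \<le> d"
    and p: "p \<in> C" "\<And>c. c \<in> C \<Longrightarrow> a \<bullet> c \<le> a \<bullet> p" and q: "\<And>c. c \<in> C \<Longrightarrow> a \<bullet> q \<le> a \<bullet> c"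
  shows "a \<bullet> (x - y) \<le> d * (a \<bullet> p - a \<bullet> q)"
proof -
  obtain u v where u: "u \<in> C" "t + x = l *\<^sub>R u" and v: "v \<in> C" "t + y = l *\<^sub>R v"
    using x y by auto
  have "x - y = (t + x) - (t + y)" by simp
  also have "\<dots> = l *\<^sub>R (u - v)" unfolding u v by (simp add: scaleR_diff_right)
  finally have "a \<bullet> (x - y) = l * (a \<bullet> u - a \<bullet> v)" by (simp add: inner_diff_right)
  also have "\<dots> \<le> l * (a \<bullet> p - a \<bullet> q)"
    using l p(2)[OF u(1)] q[OF v(1)] by (intro mult_left_mono) auto
  also have "\<dots> \<le> d * (a \<bullet> p - a \<bullet> q)"
    using l q[OF p(1)] by (intro mult_right_mono) auto
  finally show ?thesis .
qed

text \<open>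
  As the \<open>a i\<close> sum to \<open>0\<close>, each \<open>- (a i \<bullet> q i)\<close> is the sum of \<open>a j \<bullet> q i\<close> over \<open>j \<noteq> i\<close>, where each
  term is at most the maximum \<open>a j \<bullet> p j\<close>. Summed over \<open>i\<close>, every maximum is counted once for each
  index different from its own.
\<close>

lemma sum_opposite_support_le:
  fixes a p q :: "'m::finite \<Rightarrow> 'a::real_inner"
  assumes a: "(\<Sum>i\<in>UNIV. a i) = 0" and q: "\<And>i. q i \<in> C"
    and p: "\<And>i c. c \<in> C \<Longrightarrow> a i \<bullet> c \<le> a i \<bullet> p i"
  shows "- (\<Sum>i\<in>UNIV. a i \<bullet> q i) \<le> (real CARD('m) - 1) * (\<Sum>i\<in>UNIV. a i \<bullet> p i)"
proof -
  define S where "S = (\<Sum>i\<in>UNIV. a i \<bullet> p i)"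
  have "- (a i \<bullet> q i) \<le> S - a i \<bullet> p i" for i
  proof -
    have "0 = (\<Sum>j\<in>UNIV. a j) \<bullet> q i" using a by simp
    also have "\<dots> = a i \<bullet> q i + (\<Sum>j\<in>UNIV - {i}. a j \<bullet> q i)"
      by (simp add: inner_sum_left inner_add_left sum.remove[of UNIV i])
    also have "\<dots> \<le> a i \<bullet> q i + (\<Sum>j\<in>UNIV - {i}. a j \<bullet> p j)"
      using p q by (intro add_left_mono sum_mono) auto
    also have "\<dots> = a i \<bullet> q i + (S - a i \<bullet> p i)"
      unfolding S_def by (simp add: sum.remove[of UNIV i])
    finally show ?thesis by simp
  qed
  then have "(\<Sum>i\<in>UNIV. - (a i \<bullet> q i)) \<le> (\<Sum>i\<in>UNIV. S - a i \<bullet> p i)" by (intro sum_mono) auto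
  then show ?thesis by (simp add: sum_negf sum_subtractf S_def algebra_simps)
qed

lemma linear_extrema:
  fixes C :: "'a::euclidean_space set" and a :: "'i \<Rightarrow> 'a"
  assumes "compact C" "C \<noteq> {}"
  obtains p q where "\<And>i. p i \<in> C" "\<And>i. q i \<in> C"
    "\<And>i c. c \<in> C \<Longrightarrow> a i \<bullet> c \<le> a i \<bullet> p i" "\<And>i c. c \<in> C \<Longrightarrow> a i \<bullet> q i \<le> a i \<bullet> c"
proof -
  have cont: "continuous_on C (\<lambda>c. a i \<bullet> c)" for i by (intro continuous_intros)
  have "\<forall>i. \<exists>p. p \<in> C \<and> (\<forall>c\<in>C. a i \<bullet> c \<le> a i \<bullet> p)"
    using continuous_attains_sup[OF assms cont] by blast
  moreover have "\<forall>i. \<exists>q. q \<in> C \<and> (\<forall>c\<in>C. a i \<bullet> q \<le> a i \<bullet> c)"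
    using continuous_attains_inf[OF assms cont] by blast
  ultimately show thesis using that by metis
qed

text \<open>
  The core estimate: the certificate of \<open>no_common_translate_certificate\<close> contradicts the width
  bound, applied in each direction \<open>a i\<close> to \<open>x i\<close> and to the point of the inscribed copy of \<open>C\<close> that
  is lowest in that direction. The hypothesis \<open>width\<close> says that the width of \<open>K\<close> is at most \<open>d\<close> times
  the width of \<open>C\<close> in every direction.
\<close>

lemma common_translate_of_few_points:
  fixes K C :: "'a::euclidean_space set" and x :: "'m::finite \<Rightarrow> 'a"
  assumes C: "convex C" "compact C" "C \<noteq> {}"
    and width: "\<And>a p q y z. \<lbrakk>y \<in> K; z \<in> K; p \<in> C; q \<in> C; \<And>c. c \<in> C \<Longrightarrow> a \<bullet> c \<le> a \<bullet> p;
        \<And>c. c \<in> C \<Longrightarrow> a \<bullet> q \<le> a \<bullet> c\<rbrakk> \<Longrightarrow> a \<bullet> (y - z) \<le> d * (a \<bullet> p - a \<bullet> q)"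
    and x: "\<And>i. x i \<in> K" and r: "(*\<^sub>R) r ` C \<subseteq> (+) t ` K" "r \<le> d"
  shows "\<exists>t. \<forall>i. t + x i \<in> (*\<^sub>R) (real CARD('m) * d - (real CARD('m) - 1) * r) ` C"
proof (rule ccontr)
  assume no: "\<not> ?thesis"
  define l where "l = real CARD('m) * d - (real CARD('m) - 1) * r"
  obtain a where a: "(\<Sum>i\<in>UNIV. a i) = 0"
    "\<And>p. (\<And>i. p i \<in> C) \<Longrightarrow> l * (\<Sum>i\<in>UNIV. a i \<bullet> p i) < (\<Sum>i\<in>UNIV. a i \<bullet> x i)"
    using no_common_translate_certificate[OF C no] unfolding l_def by blast
  obtain p q where pq: "\<And>i. p i \<in> C" "\<And>i. q i \<in> C"
    "\<And>i c. c \<in> C \<Longrightarrow> a i \<bullet> c \<le> a i \<bullet> p i" "\<And>i c. c \<in> C \<Longrightarrow> a i \<bullet> q i \<le> a i \<bullet> c"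
    using linear_extrema[OF C(2,3)] by metis
  define P Q where "P = (\<Sum>i\<in>UNIV. a i \<bullet> p i)" and "Q = (\<Sum>i\<in>UNIV. a i \<bullet> q i)"
  have step: "a i \<bullet> x i - r * (a i \<bullet> q i) + a i \<bullet> t \<le> d * (a i \<bullet> p i - a i \<bullet> q i)" for i
  proof -
    have "r *\<^sub>R q i - t \<in> K" using r(1) pq(2)[of i] by force
    from width[OF x this pq(1,2,3,4)]
    show ?thesis by (simp add: inner_diff_right algebra_simps)
  qed
  have "(\<Sum>i\<in>UNIV. a i \<bullet> x i) = (\<Sum>i\<in>UNIV. a i \<bullet> x i) - r * Q + r * Q + (\<Sum>i\<in>UNIV. a i) \<bullet> t"
    using a(1) by simp
  also have "\<dots> = (\<Sum>i\<in>UNIV. a i \<bullet> x i - r * (a i \<bullet> q i) + a i \<bullet> t) + r * Q"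
    unfolding Q_def by (simp add: sum.distrib sum_subtractf sum_distrib_left inner_sum_left)
  also have "\<dots> \<le> (\<Sum>i\<in>UNIV. d * (a i \<bullet> p i - a i \<bullet> q i)) + r * Q"
    using step by (intro add_right_mono sum_mono)
  also have "\<dots> = d * P + (d - r) * (- Q)"
    unfolding P_def Q_def by (simp add: sum_subtractf sum_distrib_left[symmetric] algebra_simps)
  also have "\<dots> \<le> d * P + (d - r) * ((real CARD('m) - 1) * P)"
    using sum_opposite_support_le[where a = a, OF a(1) pq(2,3)] r(2)
    unfolding P_def Q_def by (intro add_left_mono mult_left_mono) auto
  also have "\<dots> = l * P" unfolding l_def by (simp add: algebra_simps)
  finally show False using a(2)[of p] pq(1) unfolding P_def by simp
qed

section \<open>The inequality\<close>

theorem theorem1p2: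
  fixes K C :: "(real ^ 'n) set"
  assumes "convex_body K" and "convex_body C" and "aff_dim C = int CARD('n)"
  shows "real CARD('n) * inradius K C + circumradius K C
           \<le> (real CARD('n) + 1) / 2 * gauge_diameter K C"
proof -
  have K: "K \<noteq> {}" "convex K" "compact K" and C: "convex C" "compact C" "C \<noteq> {}"
    using assms unfolding convex_body_def by auto
  have int: "interior C \<noteq> {}"
    using interior_rel_interior_gen[of C] rel_interior_eq_empty[OF C(1)] C(3) assms(3) by simp
  note circ = circumradius_attained[OF C(1,2) int]
  obtain c c' where c: "c \<in> C" "c' \<in> C" "c \<noteq> c'"
  proof -
    have "\<not> C \<subseteq> {c}" for c using aff_dim_subset[of C "{c}"] assms(3) by auto
    then show thesis using that C(3) by blast
  qed
  define d where "d = gauge_diameter K C / 2"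
  define r where "r = inradius K C"
  obtain t where rt: "(*\<^sub>R) r ` C \<subseteq> (+) t ` K"
    using inradius_attained[OF K(3,1) C(2) c] unfolding r_def by auto
  have pair: "circumradius {x, y} C \<le> d" if "x \<in> K" "y \<in> K" for x y
    using gauge_diameter_bounds_pairs[OF C(1,2) int K(3,1) that] unfolding d_def by simp
  have width: "a \<bullet> (x - y) \<le> d * (a \<bullet> p - a \<bullet> q)"
    if "x \<in> K" "y \<in> K" "p \<in> C" "q \<in> C" "\<And>c. c \<in> C \<Longrightarrow> a \<bullet> c \<le> a \<bullet> p"
      "\<And>c. c \<in> C \<Longrightarrow> a \<bullet> q \<le> a \<bullet> c" for a p q x y
  proof -
    obtain s where "(+) s ` {x, y} \<subseteq> (*\<^sub>R) (circumradius {x, y} C) ` C"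
      using circ(2)[of "{x, y}"] by auto
    then show ?thesis
      using circ(1)[of "{x, y}"] pair[OF that(1,2)] that
      by (intro pairs_width_le[of s x "circumradius {x, y} C" C y d p a q]) auto
  qed
  have d0: "0 \<le> d"
  proof -
    obtain k where "k \<in> K" using K by auto
    then show ?thesis using pair[of k k] circ(1)[of "{k, k}"] by auto
  qed
  \<comment> \<open>Compare the widths of \<open>r C\<close> and \<open>d C\<close> in a direction in which \<open>C\<close> has positive width.\<close>
  have rd: "r \<le> d"
  proof -
    obtain p q where pq: "p \<in> C" "q \<in> C" "\<And>z. z \<in> C \<Longrightarrow> (c - c') \<bullet> z \<le> (c - c') \<bullet> p"
      "\<And>z. z \<in> C \<Longrightarrow> (c - c') \<bullet> q \<le> (c - c') \<bullet> z"
      using linear_extrema[OF C(2,3), of "\<lambda>_::unit. c - c'"] by metis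
    have "r *\<^sub>R p - t \<in> K" "r *\<^sub>R q - t \<in> K" using rt pq(1,2) by force+
    from width[OF this pq]
    have "r * ((c - c') \<bullet> p - (c - c') \<bullet> q) \<le> d * ((c - c') \<bullet> p - (c - c') \<bullet> q)"
      by (simp add: inner_diff_right algebra_simps)
    moreover have "0 < (c - c') \<bullet> (c - c')" using c(3) by simp
    then have "0 < (c - c') \<bullet> p - (c - c') \<bullet> q"
      using pq(3)[OF c(1)] pq(4)[OF c(2)] by (simp add: inner_diff_right)
    ultimately show ?thesis by simp
  qed
  \<comment> \<open>The type \<open>'n option\<close> has \<open>n + 1\<close> elements and indexes the families to which Helly reduces.\<close>
  define l where "l = real CARD('n option) * d - (real CARD('n option) - 1) * r"
  have l_eq: "l = d + real CARD('n) * (d - r)" unfolding l_def by (simp add: algebra_simps)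
  define N where "N x = (\<lambda>z. z - x) ` ((*\<^sub>R) l ` C)" for x
  have N_iff: "s \<in> N x \<longleftrightarrow> s + x \<in> (*\<^sub>R) l ` C" for s x
    unfolding N_def by (rule mem_image_diff_iff)
  have "\<Inter>(N ` K) \<noteq> {}"
  proof (rule compact_Helly)
    show "compact S" if "S \<in> N ` K" for S
      using that unfolding N_def
      by (auto intro!: compact_continuous_image continuous_intros C(2))
    show "convex S" if "S \<in> N ` K" for S
      using that unfolding N_def
      by (auto intro!: convex_translation_subtract convex_scaling C(1))
    fix \<G> assume G: "\<G> \<subseteq> N ` K" "finite \<G>" "card \<G> \<le> DIM(real ^ 'n) + 1"
    show "\<Inter>\<G> \<noteq> {}"
    proof (cases "\<G> = {}")
      case False
      have "card \<G> \<le> CARD('n option)" using G(3) by simp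
      \<comment> \<open>A family of fewer than \<open>n + 1\<close> sets is indexed with repetitions.\<close>
      then obtain g :: "'n option \<Rightarrow> (real ^ 'n) set" where g: "range g = \<G>"
        using card_le_inj[OF G(2) finite_class.finite_UNIV] inj_on_iff_surj[OF False] by metis
      then have "\<forall>i. \<exists>x. x \<in> K \<and> g i = N x" using G(1) by blast
      then obtain x where x: "\<And>i. x i \<in> K" "\<And>i. g i = N (x i)" by metis
      have "\<exists>s. \<forall>i. s + x i \<in> (*\<^sub>R) l ` C"
        unfolding l_def
        by (rule common_translate_of_few_points[OF C _ x(1) rt rd]) (rule width)
      then obtain s where "\<And>i. s \<in> N (x i)" using N_iff by blast
      then have "s \<in> \<Inter>\<G>" unfolding g[symmetric] using x(2) by simp
      then show ?thesis by blast
    qed auto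
  qed
  then obtain s where "\<And>x. x \<in> K \<Longrightarrow> s \<in> N x" by blast
  then have "\<And>x. x \<in> K \<Longrightarrow> s + x \<in> (*\<^sub>R) l ` C" using N_iff by simp
  then have "(+) s ` K \<subseteq> (*\<^sub>R) l ` C" by auto
  then have "circumradius K C \<le> l"
    using circ(3)[OF K(3,1)] rd d0 unfolding l_eq by simp
  then show ?thesis unfolding l_eq d_def r_def by (simp add: field_simps)
qed

end
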